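(* Let $n>1$ be an odd integer and let $\zeta\in\mathbb{C}$ be a primitive $n$-th root of unity. Then $$\sum_{\tau\in D(n-1)}\mathrm{sign}(\tau)\prod_{j=1}^{n-1}\frac{1}{1-\zeta^{j-\tau(j)}}=\frac{(-1)^{\frac{n-1}{2}}}{n}\left(\left(\frac{n-1}{2}\right)!\right)^2.$$
   Context: For a positive integer $m$, $D(m)$ denotes the set of all derangements of $\{1,\dots,m\}$, i.e. permutations $\tau$ of $\{1,\dots,m\}$ such that $\tau(j)\neq j$ for all $j=1,\dots,m$. $\mathrm{sign}(\tau)\in\{1,-1\}$ is the sign of the permutation $\tau$. *)

theory Defs
  imports Complex_Main "HOL-Combinatorics.Permutations"
begin

definition derangements :: "nat \<Rightarrow> (nat \<Rightarrow> nat) set"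
  where "derangements m = {\<tau>. \<tau> permutes {1..m} \<and> (\<forall>j\<in>{1..m}. \<tau> j \<noteq> j)}"

definition primitive_root_of_unity :: "nat \<Rightarrow> complex \<Rightarrow> bool"
  where "primitive_root_of_unity n z \<longleftrightarrow>
    n > 0 \<and> z ^ n = 1 \<and> (\<forall>k. 0 < k \<and> k < n \<longrightarrow> z ^ k \<noteq> 1)"

end

theory Submission
  imports Defs "Jordan_Normal_Form.Determinant"
begin

text \<open>
  The sum is the principal minor, on the indices \<open>1, \<dots>, n - 1\<close>, of the circulant matrix with
  entries \<open>1 / (1 - \<zeta>\<^sup>j\<^sup>-\<^sup>k)\<close> off the diagonal and \<open>0\<close> on it. Its eigenvalues on the Fourier vectors
  are \<open>\<lambda>(e) = (\<Sum>w. w\<^sup>e / (1 - w))\<close>, summed over the \<open>n\<close>-th roots of unity \<open>w \<noteq> 1\<close>; since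
  \<open>\<lambda>(e) - \<lambda>(e + 1)\<close> is a power sum of these roots, they are the integers from \<open>-m\<close> to \<open>m\<close>, where
  \<open>n = 2m + 1\<close>. Exactly one of them is \<open>0\<close>, and the minor is \<open>1 / n\<close> times the product of the others.
  To see this, let \<open>C\<close> be the circulant with row \<open>0\<close> replaced by a unit vector and let the first
  column of the Fourier matrix \<open>F\<close> be the null vector. Then \<open>C F = F K U\<close> with \<open>K\<close> lower
  triangular of determinant \<open>1 / n\<close> and \<open>U\<close> upper triangular with the nonzero eigenvalues on
  the diagonal next to a single \<open>1\<close>.
\<close>

section \<open>Roots of unity, their power sums, and the circulant eigenvalues\<close>

locale primitive_root =
  fixes n :: nat and \<zeta> :: complex
  assumes primitive: "primitive_root_of_unity n \<zeta>"
begin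

lemma n_pos: "n > 0"
  and root_pow: "\<zeta> ^ n = 1"
  using primitive by (auto simp: primitive_root_of_unity_def)

lemma root_nonzero: "\<zeta> \<noteq> 0"
  using n_pos root_pow by (auto simp: power_0_left)

abbreviation roots :: "complex set"
  where "roots \<equiv> {w. w ^ n = 1}"

lemma finite_roots: "finite roots"
  using n_pos by (intro finite_nth_roots)

lemma root_in_roots_nonzero: "w \<in> roots \<Longrightarrow> w \<noteq> 0"
  using n_pos by (auto simp: power_0_left)

lemma powi_in_roots: "\<zeta> powi a \<in> roots"
proof -
  have "(\<zeta> powi a) ^ n = \<zeta> powi (int n * a)"
    by (simp add: power_int_power' mult.commute)
  also have "\<dots> = 1"
    by (simp add: power_int_mult root_pow)
  finally show ?thesis
    by simp
qed

lemma powi_eq_1_iff: "\<zeta> powi a = 1 \<longleftrightarrow> int n dvd a"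
proof -
  have "\<zeta> powi a = \<zeta> powi (int n * (a div int n) + a mod int n)"
    by simp
  also have "\<dots> = (\<zeta> powi int n) powi (a div int n) * \<zeta> powi (a mod int n)"
    using root_nonzero by (subst power_int_add) (simp_all add: power_int_mult)
  also have "\<dots> = \<zeta> ^ nat (a mod int n)"
    using n_pos by (simp add: root_pow power_int_nonneg_exp)
  finally have eq: "\<zeta> powi a = \<zeta> ^ nat (a mod int n)" .
  have "nat (a mod int n) < n"
    using n_pos by (simp add: nat_less_iff)
  then have "\<zeta> ^ nat (a mod int n) = 1 \<longleftrightarrow> nat (a mod int n) = 0"
    using primitive unfolding primitive_root_of_unity_def by (metis gr0I power_0)
  also have "\<dots> \<longleftrightarrow> a mod int n = 0"
    using n_pos pos_mod_sign[of "int n" a] by linarith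
  finally show ?thesis
    by (simp add: eq dvd_eq_mod_eq_0)
qed

lemma dvd_index_diff: "j < n \<Longrightarrow> k < n \<Longrightarrow> int n dvd int j - int k \<longleftrightarrow> j = k"
  using zdvd_imp_le[of "int n" "int j - int k"]
    zdvd_imp_le[of "int n" "int k - int j"] dvd_minus_iff[of "int n" "int j - int k"]
  by (cases j k rule: linorder_cases) auto

lemma bij_betw_powi_roots: "bij_betw (\<lambda>k. \<zeta> powi (a - int k)) {0..<n} roots"
proof -
  have inj: "inj_on (\<lambda>k. \<zeta> powi (a - int k)) {0..<n}"
  proof (rule inj_onI)
    fix j k assume jk: "j \<in> {0..<n}" "k \<in> {0..<n}"
      and eq: "\<zeta> powi (a - int j) = \<zeta> powi (a - int k)"
    have "\<zeta> powi (int j - int k) = \<zeta> powi ((a - int k) - (a - int j))"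
      by simp
    also have "\<dots> = 1"
      using root_nonzero eq by (subst power_int_diff) simp_all
    finally have "int n dvd int j - int k"
      by (simp only: powi_eq_1_iff)
    then show "j = k"
      using jk dvd_index_diff by simp
  qed
  have "(\<lambda>k. \<zeta> powi (a - int k)) ` {0..<n} = roots"
    using finite_roots powi_in_roots card_image[OF inj] card_roots_unity_eq[OF n_pos]
    by (intro card_subset_eq) auto
  with inj show ?thesis
    by (simp add: bij_betw_def)
qed

lemma sum_powi_reindex: "(\<Sum>k = 0..<n. g (\<zeta> powi (a - int k))) = (\<Sum>w\<in>roots. g w)"
  using bij_betw_powi_roots by (rule sum.reindex_bij_betw)

lemma sum_roots_powi: "(\<Sum>w\<in>roots. w powi e) = (if int n dvd e then of_nat n else 0)"
proof (cases "int n dvd e")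
  case True
  have "w powi e = 1" if "w \<in> roots" for w
    using True that by (auto elim!: dvdE simp: power_int_mult)
  then show ?thesis
    using True card_roots_unity_eq[OF n_pos] by simp
next
  case False
  \<comment> \<open>Rotation by \<open>\<zeta>\<close> permutes the roots and scales the sum by
    \<open>\<zeta> powi e\<close>, which is not 1 here; so the sum vanishes.\<close>
  have "bij_betw ((*) \<zeta>) roots roots"
    by (rule bij_betwI[where g = "\<lambda>w. w / \<zeta>"])
      (use root_nonzero root_pow in \<open>auto simp: power_mult_distrib power_divide\<close>)
  then have "(\<Sum>w\<in>roots. w powi e) = (\<Sum>w\<in>roots. (\<zeta> * w) powi e)"
    by (rule sum.reindex_bij_betw[symmetric])
  also have "\<dots> = \<zeta> powi e * (\<Sum>w\<in>roots. w powi e)"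
    by (simp add: power_int_mult_distrib sum_distrib_left)
  finally have "(1 - \<zeta> powi e) * (\<Sum>w\<in>roots. w powi e) = 0"
    by (simp add: algebra_simps)
  then show ?thesis
    using False powi_eq_1_iff[of e] by simp
qed

text \<open>The term at \<open>w = 1\<close> vanishes because \<open>x / 0 = 0\<close>.\<close>

definition eigval :: "int \<Rightarrow> complex"
  where "eigval e = (\<Sum>w\<in>roots. w powi e / (1 - w))"

text \<open>For a root \<open>w \<noteq> 1\<close> the two terms differ by exactly
  \<open>w powi e\<close>. The subtracted 1 is the term that the full power sum has at
  \<open>w = 1\<close> and \<open>eigval\<close> lacks.\<close>

lemma eigval_diff: "eigval e - eigval (e + 1) = (if int n dvd e then of_nat n else 0) - 1"
proof -
  have "eigval e - eigval (e + 1) = (\<Sum>w\<in>roots. w powi e / (1 - w) - w powi (e + 1) / (1 - w))"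
    by (simp add: eigval_def sum_subtractf)
  also have "\<dots> = (\<Sum>w\<in>roots. w powi e - (if w = 1 then 1 else 0))"
  proof (rule sum.cong[OF refl])
    fix w assume "w \<in> roots"
    then have "w powi (e + 1) = w powi e * w"
      using root_in_roots_nonzero by (simp add: power_int_add)
    then have "w powi e - w powi (e + 1) = w powi e * (1 - w)"
      by (simp add: algebra_simps)
    then show "w powi e / (1 - w) - w powi (e + 1) / (1 - w) = w powi e - (if w = 1 then 1 else 0)"
      by (cases "w = 1") (simp_all only: diff_divide_distrib[symmetric], simp_all)
  qed
  also have "\<dots> = (\<Sum>w\<in>roots. w powi e) - 1"
    using finite_roots by (simp add: sum_subtractf)
  finally show ?thesis
    by (simp only: sum_roots_powi)
qed

text \<open>Pairing \<open>w\<close> with \<open>1 / w\<close>: \<open>1 / (1 - w) + 1 / (1 - 1 / w) = 1\<close> for \<open>w \<noteq> 0, 1\<close>.\<close>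

lemma eigval_0: "eigval 0 = (of_nat n - 1) / 2"
proof -
  have "bij_betw inverse roots roots"
    by (rule bij_betwI[where g = inverse]) (auto simp: power_inverse)
  then have "eigval 0 = (\<Sum>w\<in>roots. 1 / (1 - inverse w))"
    by (simp add: eigval_def sum.reindex_bij_betw[of inverse roots roots "\<lambda>w. 1 / (1 - w)"])
  then have "2 * eigval 0 = (\<Sum>w\<in>roots. 1 / (1 - w) + 1 / (1 - inverse w))"
    by (simp add: eigval_def sum.distrib)
  also have "\<dots> = (\<Sum>w\<in>roots. 1 - (if w = 1 then 1 else 0))"
  proof (rule sum.cong[OF refl])
    fix w assume "w \<in> roots"
    then have "w \<noteq> 0"
      by (rule root_in_roots_nonzero)
    then show "1 / (1 - w) + 1 / (1 - inverse w) = 1 - (if w = 1 then 1 else 0)"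
      by (cases "w = 1") (auto simp: divide_simps, simp add: algebra_simps)
  qed
  also have "\<dots> = of_nat n - 1"
    using finite_roots card_roots_unity_eq[OF n_pos] by (simp add: sum_subtractf)
  finally show ?thesis
    by (simp add: mult.commute)
qed

text \<open>By \<open>eigval_diff\<close>, the step from exponent 0 to 1 lowers the value by
  \<open>n - 1\<close>; each later step before the next multiple of \<open>n\<close> raises it by
  1.\<close>

lemma eigval_Suc: "i < n \<Longrightarrow> eigval (int i + 1) = of_nat i - (of_nat n - 1) / 2"
proof (induction i)
  case 0
  then show ?case
    using eigval_diff[of 0] by (simp add: eigval_0 field_simps)
next
  case (Suc i)
  then have "\<not> int n dvd int i + 1"
    by (auto dest: zdvd_imp_le)
  then have "eigval (int (Suc i) + 1) = eigval (int i + 1) + 1"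
    using eigval_diff[of "int i + 1"] by (simp add: algebra_simps)
  then show ?case
    using Suc.IH Suc.prems by simp
qed

lemma eigval_add_period: "eigval (e + int n) = eigval e"
  unfolding eigval_def
proof (rule sum.cong[OF refl])
  fix w assume "w \<in> roots"
  then show "w powi (e + int n) / (1 - w) = w powi e / (1 - w)"
    using root_in_roots_nonzero[of w] by (simp add: power_int_add)
qed

end

section \<open>Odd order: the eigenvalues in shifted order and their product\<close>

locale odd_primitive_root = primitive_root +
  fixes m :: nat
  assumes n_eq: "n = 2 * m + 1"
begin

lemma of_nat_n: "of_nat n = 2 * of_nat m + (1 :: complex)"
  by (simp add: n_eq)

text \<open>The shift by \<open>m + 1\<close> puts the eigenvalue \<open>0\<close> at index \<open>0\<close>, which makes the factors
  \<open>K\<close> and \<open>U\<close> below triangular.\<close>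

definition shifted_eigval :: "nat \<Rightarrow> complex"
  where "shifted_eigval r = (if r \<le> m then of_nat r else of_nat r - of_nat n)"

lemma eigval_eq_shifted_eigval:
  assumes "r < n"
  shows "eigval (int r + int m + 1) = shifted_eigval r"
proof (cases "r \<le> m")
  case True
  then have "r + m < n"
    by (simp add: n_eq)
  then show ?thesis
    using True eigval_Suc[of "r + m"] by (simp add: shifted_eigval_def of_nat_n)
next
  case False
  \<comment> \<open>The exponent now exceeds \<open>n\<close>, so it is moved back by one period
    into the range of \<open>eigval_Suc\<close>.\<close>
  then have "int r + int m + 1 = (int (r - m - 1) + 1) + int n"
    by (simp add: n_eq of_nat_diff)
  then have "eigval (int r + int m + 1) = eigval (int (r - m - 1) + 1)"
    by (simp only: eigval_add_period)
  also have "\<dots> = of_nat (r - m - 1) - (of_nat n - 1) / 2"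
    using False assms by (intro eigval_Suc) (simp add: n_eq)
  also have "\<dots> = shifted_eigval r"
    using False by (simp add: shifted_eigval_def of_nat_n of_nat_diff)
  finally show ?thesis .
qed

lemma prod_shifted_eigval: "(\<Prod>r = 1..<n. shifted_eigval r) = (-1) ^ m * (fact m)\<^sup>2"
proof -
  have "{1..<n} = {1..m} \<union> {m + 1..2 * m}"
    by (auto simp: n_eq)
  then have "(\<Prod>r = 1..<n. shifted_eigval r) = (\<Prod>r = 1..m. shifted_eigval r) * (\<Prod>r = m + 1..2 * m. shifted_eigval r)"
    by (simp add: prod.union_disjoint)
  also have "(\<Prod>r = 1..m. shifted_eigval r) = fact m"
    by (simp add: shifted_eigval_def fact_prod)
  \<comment> \<open>The reflection of \<open>r\<close> to \<open>n - r\<close> turns the factors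
    \<open>r - n\<close> into the negatives of \<open>1, ..., m\<close>.\<close>
  also have "(\<Prod>r = m + 1..2 * m. shifted_eigval r) = (\<Prod>r = 1..m. - of_nat r)"
    by (rule prod.reindex_bij_witness[of _ "\<lambda>r. 2 * m + 1 - r" "\<lambda>r. 2 * m + 1 - r"])
      (auto simp: shifted_eigval_def of_nat_n of_nat_diff)
  also have "\<dots> = (-1) ^ m * fact m"
    by (simp add: fact_prod prod_uminus)
  finally show ?thesis
    by (simp add: power2_eq_square)
qed

section \<open>Factorisation through the Fourier matrix\<close>

definition fourier :: "nat \<Rightarrow> nat \<Rightarrow> complex"
  where "fourier j r = \<zeta> powi (- int j * (int r + int m + 1))"

definition F :: "complex mat"
  where "F = mat n n (\<lambda>(j, r). fourier j r)"

text \<open>The link between the two factorisations: \<open>F * K = H\<close> and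
  \<open>C * F = H * U\<close>.\<close>

definition H :: "complex mat"
  where "H = mat n n (\<lambda>(j, r). if r = 0 then (if j = 0 then 1 else 0) else fourier j r)"

text \<open>Column 0 averages all Fourier columns, which yields the unit vector at index 0.\<close>

definition K :: "complex mat"
  where "K = mat n n (\<lambda>(s, r). if r = 0 then 1 / of_nat n else if s = r then 1 else 0)"

definition U :: "complex mat"
  where "U = mat n n (\<lambda>(s, r). if s = r then (if r = 0 then 1 else shifted_eigval r)
                               else if s = 0 then 1 - shifted_eigval r else 0)"

text \<open>The diagonal vanishes except at index \<open>0\<close>, because \<open>1 / 0 = 0\<close>.\<close>

definition C :: "complex mat"
  where "C = mat n n (\<lambda>(j, k). if j = 0 then (if k = 0 then 1 else 0)
                               else 1 / (1 - \<zeta> powi (int j - int k)))"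

lemma carrier_mats [simp]:
  "F \<in> carrier_mat n n" "H \<in> carrier_mat n n" "K \<in> carrier_mat n n"
  "U \<in> carrier_mat n n" "C \<in> carrier_mat n n"
  by (simp_all add: F_def H_def K_def U_def C_def)

lemma sum_powi_mult:
  "(\<Sum>r = 0..<n. \<zeta> powi (- e * (int r + int m + 1))) = (if int n dvd e then of_nat n else 0)"
proof -
  have "(\<Sum>r = 0..<n. \<zeta> powi (- e * (int r + int m + 1)))
      = (\<Sum>r = 0..<n. (\<zeta> powi (- (int m + 1) - int r)) powi e)"
    by (simp add: power_int_mult[symmetric] algebra_simps)
  also have "\<dots> = (\<Sum>w\<in>roots. w powi e)"
    by (rule sum_powi_reindex)
  finally show ?thesis
    by (simp only: sum_roots_powi)
qed

text \<open>Orthogonality of characters: the matrix with the opposite exponents, transposed, inverts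
  \<open>F\<close> up to the factor \<open>n\<close>.\<close>

lemma det_F_nonzero: "det F \<noteq> 0"
proof -
  define G where "G = mat n n (\<lambda>(r, k). \<zeta> powi (int k * (int r + int m + 1)))"
  have G [simp]: "G \<in> carrier_mat n n"
    by (simp add: G_def)
  have "F * G = of_nat n \<cdot>\<^sub>m 1\<^sub>m n"
  proof (rule eq_matI)
    fix j k assume "j < dim_row (of_nat n \<cdot>\<^sub>m 1\<^sub>m n :: complex mat)"
      "k < dim_col (of_nat n \<cdot>\<^sub>m 1\<^sub>m n :: complex mat)"
    then have jk: "j < n" "k < n"
      by simp_all
    have "(F * G) $$ (j, k)
        = (\<Sum>r = 0..<n. fourier j r * \<zeta> powi (int k * (int r + int m + 1)))"
      using jk by (simp add: F_def G_def scalar_prod_def)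
    also have "\<dots> = (\<Sum>r = 0..<n. \<zeta> powi (- (int j - int k) * (int r + int m + 1)))"
      using root_nonzero
      by (simp add: fourier_def power_int_add[symmetric] algebra_simps)
    also have "\<dots> = (if j = k then of_nat n else 0)"
      using jk by (simp only: sum_powi_mult dvd_index_diff)
    finally show "(F * G) $$ (j, k) = (of_nat n \<cdot>\<^sub>m 1\<^sub>m n) $$ (j, k)"
      using jk by simp
  qed (simp_all add: F_def G_def)
  then have "det F * det G = of_nat n ^ n"
    by (metis G carrier_mats(1) det_mult det_one det_smult index_one_mat(3) mult.right_neutral
        index_one_mat(2))
  then show ?thesis
    using n_pos by auto
qed

lemma F_mult_K: "F * K = H"
proof (rule eq_matI)
  fix j r assume "j < dim_row H" "r < dim_col H"
  then have jr: "j < n" "r < n"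
    by (simp_all add: H_def)
  show "(F * K) $$ (j, r) = H $$ (j, r)"
  proof (cases "r = 0")
    case True
    have "(F * K) $$ (j, r) = (\<Sum>s = 0..<n. fourier j s) / of_nat n"
      using True jr by (simp add: F_def K_def scalar_prod_def sum_divide_distrib)
    also have "(\<Sum>s = 0..<n. fourier j s) = (if j = 0 then of_nat n else 0)"
      using jr dvd_index_diff[of j 0] n_pos by (simp only: fourier_def sum_powi_mult) simp
    finally show ?thesis
      using True jr n_pos by (simp add: H_def)
  next
    case False
    then show ?thesis
      using jr by (simp add: F_def K_def H_def scalar_prod_def
          if_distrib[of "(*) c" for c] cong: if_cong)
  qed
qed (simp_all add: F_def K_def H_def)

text \<open>With \<open>w = \<zeta> powi (int j - int k)\<close>, the entry
  \<open>fourier k r\<close> is \<open>fourier j r\<close> times a power of \<open>w\<close>, and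
  \<open>w\<close> runs over all roots as \<open>k\<close> does.\<close>

lemma circulant_fourier:
  assumes "r < n"
  shows "(\<Sum>k = 0..<n. 1 / (1 - \<zeta> powi (int j - int k)) * fourier k r) = shifted_eigval r * fourier j r"
proof -
  let ?e = "int r + int m + 1"
  have shift: "fourier k r = fourier j r * (\<zeta> powi (int j - int k)) powi ?e" for k
    using root_nonzero
    by (simp add: fourier_def power_int_mult[symmetric] power_int_add[symmetric] algebra_simps)
  have "(\<Sum>k = 0..<n. 1 / (1 - \<zeta> powi (int j - int k)) * fourier k r)
      = fourier j r * (\<Sum>k = 0..<n. (\<zeta> powi (int j - int k)) powi ?e / (1 - \<zeta> powi (int j - int k)))"
    unfolding sum_distrib_left by (intro sum.cong refl) (subst shift, simp)
  also have "\<dots> = fourier j r * eigval ?e"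
    unfolding eigval_def by (subst sum_powi_reindex) (rule refl)
  finally show ?thesis
    using eigval_eq_shifted_eigval[OF assms] by simp
qed

text \<open>Row 0 of \<open>C\<close> picks out \<open>fourier 0 r = 1\<close>, while the other rows
  scale by the eigenvalue. So column \<open>r > 0\<close> is \<open>shifted_eigval r\<close> times
  the Fourier column plus \<open>1 - shifted_eigval r\<close> times the unit vector; column 0, with
  eigenvalue 0, is the unit vector itself.\<close>

lemma C_mult_F: "C * F = H * U"
proof (rule eq_matI)
  fix j r assume "j < dim_row (H * U)" "r < dim_col (H * U)"
  then have jr: "j < n" "r < n"
    by (simp_all add: H_def U_def)
  have "(C * F) $$ (j, r) = (if j = 0 then 1 else shifted_eigval r * fourier j r)"
  proof (cases "j = 0")
    case True
    then show ?thesis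
      using jr by (simp add: C_def F_def scalar_prod_def fourier_def
          if_distrib[of "\<lambda>x. x * c" for c] cong: if_cong)
  next
    case False
    then show ?thesis
      using jr by (simp add: C_def F_def scalar_prod_def circulant_fourier[symmetric])
  qed
  moreover have HU: "(H * U) $$ (j, r) = (\<Sum>s = 0..<n. H $$ (j, s) * U $$ (s, r))"
    using jr by (simp add: H_def U_def scalar_prod_def)
  have "(H * U) $$ (j, r) = (if j = 0 then 1 else shifted_eigval r * fourier j r)"
  proof (cases "r = 0")
    case True
    have "(H * U) $$ (j, r) = (\<Sum>s = 0..<n. if s = 0 then if j = 0 then 1 else 0 else 0)"
      unfolding HU using True jr by (intro sum.cong) (auto simp: H_def U_def)
    then show ?thesis
      using True n_pos by (simp add: shifted_eigval_def)
  next
    case False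
    have "(H * U) $$ (j, r) = (\<Sum>s = 0..<n. (if s = r then fourier j r * shifted_eigval r else 0)
        + (if s = 0 then if j = 0 then 1 - shifted_eigval r else 0 else 0))"
      unfolding HU using False jr by (intro sum.cong) (auto simp: H_def U_def)
    then show ?thesis
      using jr n_pos by (auto simp: sum.distrib fourier_def)
  qed
  ultimately show "(C * F) $$ (j, r) = (H * U) $$ (j, r)"
    by simp
qed (simp_all add: C_def F_def H_def U_def)

section \<open>Determinants and the sum over derangements\<close>

lemma det_K: "det K = 1 / of_nat n"
proof -
  have "det K = prod_list (diag_mat K)"
    by (rule det_lower_triangular[of n]) (auto simp: K_def)
  also have "\<dots> = (\<Prod>r = 0..<n. K $$ (r, r))"
    by (simp add: prod_list_diag_prod K_def)
  also have "\<dots> = (\<Prod>r = 0..<n. if r = 0 then 1 / of_nat n else 1)"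
    by (rule prod.cong) (auto simp: K_def)
  also have "\<dots> = 1 / of_nat n"
    using n_pos by simp
  finally show ?thesis .
qed

lemma det_U: "det U = (\<Prod>r = 1..<n. shifted_eigval r)"
proof -
  have "det U = prod_list (diag_mat U)"
    by (rule det_upper_triangular[of _ n]) (auto simp: U_def)
  also have "\<dots> = (\<Prod>r = 0..<n. U $$ (r, r))"
    by (simp add: prod_list_diag_prod U_def)
  also have "\<dots> = U $$ (0, 0) * (\<Prod>r = 1..<n. U $$ (r, r))"
    using n_pos by (simp add: prod.atLeast_Suc_lessThan)
  also have "\<dots> = (\<Prod>r = 1..<n. shifted_eigval r)"
    using n_pos by (simp add: U_def)
  finally show ?thesis .
qed

lemma det_C: "det C = (-1) ^ m / of_nat n * (fact m)\<^sup>2"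
proof -
  have "det C * det F = det (C * F)"
    by (simp add: det_mult[of _ n])
  also have "C * F = F * K * U"
    by (simp only: C_mult_F F_mult_K)
  also have "det (F * K * U) = det F * det K * det U"
    by (simp add: det_mult[of _ n] mult_carrier_mat[of _ n n])
  finally have "det C = det K * det U"
    using det_F_nonzero by simp
  then show ?thesis
    unfolding det_K det_U prod_shifted_eigval by simp
qed

text \<open>In the Leibniz expansion, row 0 forces \<open>\<tau> 0 = 0\<close>, and the zero
  diagonal of the other rows removes every permutation with a further fixed point.\<close>

lemma det_C_eq_sum_derangements:
  "det C = (\<Sum>\<tau>\<in>derangements (n - 1).
      of_int (sign \<tau>) * (\<Prod>j=1..n - 1. 1 / (1 - \<zeta> powi (int j - int (\<tau> j)))))"
proof -
  let ?t = "\<lambda>\<tau>. of_int (sign \<tau>) * (\<Prod>i = 0..<n. C $$ (i, \<tau> i))"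
  have range: "{0..<n} = insert 0 {1..n - 1}"
    using n_pos by auto
  have "det C = (\<Sum>\<tau> | \<tau> permutes {0..<n}. ?t \<tau>)"
    by (simp add: det_def'[of _ n])
  also have "\<dots> = (\<Sum>\<tau>\<in>derangements (n - 1). ?t \<tau>)"
  proof (rule sum.mono_neutral_right)
    show "derangements (n - 1) \<subseteq> {\<tau>. \<tau> permutes {0..<n}}"
      unfolding range derangements_def by (auto intro: permutes_imp_permutes_insert)
    show "\<forall>\<tau>\<in>{\<tau>. \<tau> permutes {0..<n}} - derangements (n - 1). ?t \<tau> = 0"
    proof
      fix \<tau> assume \<tau>: "\<tau> \<in> {\<tau>. \<tau> permutes {0..<n}} - derangements (n - 1)"
      then have perm: "\<tau> permutes {0..<n}"
        by simp
      have "\<exists>i\<in>{0..<n}. C $$ (i, \<tau> i) = 0"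
      proof (cases "\<tau> 0 = 0")
        case True
        then have "\<tau> permutes {1..n - 1}"
          using perm unfolding range by (intro permutes_superset[OF perm[unfolded range]]) auto
        with \<tau> obtain j where "j \<in> {1..n - 1}" "\<tau> j = j"
          by (auto simp: derangements_def)
        then show ?thesis
          by (intro bexI[of _ j]) (auto simp: C_def)
      next
        case False
        moreover have "\<tau> 0 < n"
          using permutes_in_image[OF perm, of 0] n_pos by simp
        ultimately show ?thesis
          using n_pos by (intro bexI[of _ 0]) (auto simp: C_def)
      qed
      then have "(\<Prod>i = 0..<n. C $$ (i, \<tau> i)) = 0"
        by (intro prod_zero) auto
      then show "?t \<tau> = 0"
        by simp
    qed
  qed (simp add: finite_permutations)
  also have "\<dots> = (\<Sum>\<tau>\<in>derangements (n - 1).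
      of_int (sign \<tau>) * (\<Prod>j=1..n - 1. 1 / (1 - \<zeta> powi (int j - int (\<tau> j)))))"
  proof (rule sum.cong[OF refl])
    fix \<tau> assume "\<tau> \<in> derangements (n - 1)"
    then have perm: "\<tau> permutes {1..n - 1}"
      by (simp add: derangements_def)
    then have "\<tau> 0 = 0"
      by (rule permutes_not_in) simp
    moreover have "\<tau> j < n" if "j \<in> {1..n - 1}" for j
      using permutes_in_image[OF perm, of j] that n_pos by auto
    ultimately have "(\<Prod>i = 0..<n. C $$ (i, \<tau> i))
        = (\<Prod>j = 1..n - 1. 1 / (1 - \<zeta> powi (int j - int (\<tau> j))))"
      \<comment> \<open>The factor at index 0 is \<open>C $$ (0, 0) = 1\<close>.\<close>
      using n_pos unfolding range by (subst prod.insert) (auto simp: C_def intro!: prod.cong)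
    then show "?t \<tau> = of_int (sign \<tau>) * (\<Prod>j=1..n - 1. 1 / (1 - \<zeta> powi (int j - int (\<tau> j))))"
      by simp
  qed
  finally show ?thesis .
qed

end

theorem theorem1p1:
  fixes n :: nat and \<zeta> :: complex
  assumes "n > 1" and "odd n" and "primitive_root_of_unity n \<zeta>"
  shows "(\<Sum>\<tau>\<in>derangements (n - 1).
            of_int (sign \<tau>) * (\<Prod>j=1..n - 1. 1 / (1 - \<zeta> powi (int j - int (\<tau> j)))))
         = (-1) ^ ((n - 1) div 2) / of_nat n * (fact ((n - 1) div 2))\<^sup>2"
proof -
  interpret odd_primitive_root n \<zeta> "(n - 1) div 2"
    using assms by unfold_locales (auto elim!: oddE)
  show ?thesis
    using det_C det_C_eq_sum_derangements by simp
qed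

end
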